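(* Let $F$ be an Archimedean vector lattice and let $H\subset F$ be an ideal. The following conditions are equivalent: (i) $H$ is a projection band in $F$; (ii) every $G\subset H_+$ which is order bounded in $F$ is order bounded in $H$; (iii) every disjoint $G\subset H_+$ which is order bounded in $F$ is order bounded in $H$; (iv) there is an ideal $E\subset H$ which is order dense in $H$ and such that every disjoint $G\subset E_+$ which is order bounded in $F$ is order bounded in $H$. Moreover, if $H$ contains a countably generated order dense (in $H$) ideal $E\subset H$ such that every countable disjoint $G\subset E_+$ which is order bounded in $F$ is order bounded in $H$, then $H$ is a projection band.
   Context: An ideal of a vector lattice $F$ is a linear subspace $E\subset F$ such that $|f|\le|e|$, $e\in E$, $f\in F$ imply $f\in E$. For $G\subset F$, $G_+=\{g\in G: g\ge 0\}$ and $G^d=\{f\in F: |f|\wedge|g|=0\text{ for all } g\in G\}$. An ideal $H\subset F$ is a projection band if $F=H+H^d$. A set $G$ is disjoint if its distinct elements are pairwise disjoint ($|g|\wedge|h|=0$). A set $G\subset H_+$ is order bounded in $F$ (resp. in $H$) if there is $f\in F$ (resp. $f\in H$) with $g\le f$ for all $g\in G$. A sublattice $E\subset H$ is order dense in $H$ if for every $0<h\in H$ there is $e\in E$ with $0<e\le h$. An ideal is countably generated if it is the smallest ideal containing some countable set. *)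

theory Defs
  imports "HOL-Analysis.Analysis" "HOL-Library.Lattice_Algebras"
begin

(* A real vector lattice is a type in both ordered_real_vector and
   lattice_ab_group_add_abs; the latter provides \<bar>x\<bar> = sup x (- x). *)
class archimedean_vector_lattice = ordered_real_vector + lattice_ab_group_add_abs +
  assumes archimedean: "(\<And>n::nat. real n *\<^sub>R x \<le> y) \<Longrightarrow> x \<le> 0"

instance real :: archimedean_vector_lattice
proof
  fix x y :: real
  assume *: "\<And>n::nat. real n *\<^sub>R x \<le> y"
  show "x \<le> 0"
  proof (rule ccontr)
    assume "\<not> x \<le> 0"
    then obtain n where "y < real n * x"
      using reals_Archimedean3[of x] by (auto simp: not_le)
    with *[of n] show False by simp
  qed
qed

definition vl_ideal :: "'a::{ordered_real_vector, lattice_ab_group_add_abs} set \<Rightarrow> bool" where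
  "vl_ideal E \<longleftrightarrow> subspace E \<and> (\<forall>e\<in>E. \<forall>f. \<bar>f\<bar> \<le> \<bar>e\<bar> \<longrightarrow> f \<in> E)"

definition vl_sublattice :: "'a::{ordered_real_vector, lattice_ab_group_add_abs} set \<Rightarrow> bool" where
  "vl_sublattice E \<longleftrightarrow> subspace E \<and> (\<forall>x\<in>E. \<forall>y\<in>E. sup x y \<in> E \<and> inf x y \<in> E)"

definition positive_part :: "'a::{ordered_real_vector, lattice_ab_group_add_abs} set \<Rightarrow> 'a set" where
  "positive_part G = {g \<in> G. 0 \<le> g}"

definition disjoint_complement :: "'a::{ordered_real_vector, lattice_ab_group_add_abs} set \<Rightarrow> 'a set" where
  "disjoint_complement G = {f. \<forall>g\<in>G. inf \<bar>f\<bar> \<bar>g\<bar> = 0}"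

definition projection_band :: "'a::{ordered_real_vector, lattice_ab_group_add_abs} set \<Rightarrow> bool" where
  "projection_band H \<longleftrightarrow>
     vl_ideal H \<and> {h + k | h k. h \<in> H \<and> k \<in> disjoint_complement H} = UNIV"

definition disjoint_elements :: "'a::{ordered_real_vector, lattice_ab_group_add_abs} set \<Rightarrow> bool" where
  "disjoint_elements G \<longleftrightarrow> pairwise (\<lambda>g h. inf \<bar>g\<bar> \<bar>h\<bar> = 0) G"

(* The bound must lie in X; boundedness in the whole vector lattice is X = UNIV. *)
definition order_bounded_in :: "'a::{ordered_real_vector, lattice_ab_group_add_abs} set \<Rightarrow> 'a set \<Rightarrow> bool" where
  "order_bounded_in G X \<longleftrightarrow> (\<exists>f\<in>X. \<forall>g\<in>G. g \<le> f)"

definition order_dense_in :: "'a::{ordered_real_vector, lattice_ab_group_add_abs} set \<Rightarrow> 'a set \<Rightarrow> bool" where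
  "order_dense_in E H \<longleftrightarrow>
     vl_sublattice E \<and> E \<subseteq> H \<and> (\<forall>h\<in>H. 0 < h \<longrightarrow> (\<exists>e\<in>E. 0 < e \<and> e \<le> h))"

definition countably_generated_ideal :: "'a::{ordered_real_vector, lattice_ab_group_add_abs} set \<Rightarrow> bool" where
  "countably_generated_ideal E \<longleftrightarrow> (\<exists>S. countable S \<and> E = vl_ideal hull S)"

lemma vl_ideal_imp_vl_sublattice:
  assumes E: "vl_ideal E"
  shows "vl_sublattice E"
proof -
  have sub: "subspace E" and solid: "\<And>e f. e \<in> E \<Longrightarrow> \<bar>f\<bar> \<le> \<bar>e\<bar> \<Longrightarrow> f \<in> E"
    using E by (auto simp: vl_ideal_def)
  have "sup x y \<in> E \<and> inf x y \<in> E" if "x \<in> E" "y \<in> E" for x y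
  proof -
    let ?z = "\<bar>x\<bar> + \<bar>y\<bar>"
    have "\<bar>x\<bar> \<in> E" "\<bar>y\<bar> \<in> E"
      using solid[OF \<open>x \<in> E\<close>, of "\<bar>x\<bar>"] solid[OF \<open>y \<in> E\<close>, of "\<bar>y\<bar>"] by simp_all
    then have z: "?z \<in> E" by (rule subspace_add[OF sub])
    have nn: "0 \<le> \<bar>x\<bar>" "0 \<le> \<bar>y\<bar>" by (rule abs_ge_zero)+
    have x: "x \<le> ?z" "- x \<le> ?z"
      using add_mono[OF abs_ge_self[of x] nn(2)] add_mono[OF abs_ge_minus_self[of x] nn(2)] by simp_all
    have y: "y \<le> ?z" "- y \<le> ?z"
      using add_mono[OF nn(1) abs_ge_self[of y]] add_mono[OF nn(1) abs_ge_minus_self[of y]] by simp_all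
    have "\<bar>sup x y\<bar> \<le> ?z"
    proof (rule abs_leI)
      show "sup x y \<le> ?z" using x y by simp
      show "- sup x y \<le> ?z" unfolding neg_sup_eq_inf by (rule le_infI1[OF x(2)])
    qed
    moreover have "\<bar>inf x y\<bar> \<le> ?z"
    proof (rule abs_leI)
      show "inf x y \<le> ?z" by (rule le_infI1[OF x(1)])
      show "- inf x y \<le> ?z" unfolding neg_inf_eq_sup using x y by simp
    qed
    moreover have "?z \<le> \<bar>?z\<bar>" by (rule abs_ge_self)
    ultimately show ?thesis
      using solid[OF z] order_trans by blast
  qed
  then show ?thesis using sub by (auto simp: vl_sublattice_def)
qed

lemma vl_ideal_vl_ideal_hull: "vl_ideal (vl_ideal hull S)"
proof (rule hull_in)
  fix T :: "'a set set"
  assume "\<forall>s\<in>T. vl_ideal s"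
  then show "vl_ideal (\<Inter> T)"
    by (auto simp: vl_ideal_def intro!: subspace_Inter)
qed

end

theory Submission
  imports Defs
begin

text \<open>
  If \<open>F = H + H\<^sup>d\<close> and \<open>f = h + k\<close> is the corresponding splitting of an upper bound of
  \<open>G \<subseteq> H\<^sub>+\<close>, then \<open>\<bar>h\<bar>\<close> bounds \<open>G\<close>, because elements of \<open>H\<close> do not meet \<open>k\<close>
  (\<open>order_bounded_in_projection_band\<close>). The content is in the converse, where only bounds for
  disjoint sets are given.

  First, it suffices to find, for every \<open>f \<ge> 0\<close>, one \<open>h \<in> H\<close> that dominates all of
  \<open>E \<inter> [0, f]\<close>: if \<open>0 < e \<le> f - inf f h\<close> with \<open>e \<in> E\<close>, then by induction all multiples of
  \<open>e\<close> stay below \<open>f\<close>, hence below \<open>h\<close>, against the Archimedean property; as \<open>E\<close> is order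
  dense in \<open>H\<close>, the remainder \<open>f - inf f h\<close> is disjoint from \<open>H\<close>
  (\<open>projection_band_of_interval_bounded\<close>).

  To find \<open>h\<close>, picture \<open>f\<close> as the constant function 1 on a space and let \<open>d \<ge> 0\<close> lie in \<open>E\<close>.
  The functions \<open>2\<^sup>n d\<close> exhaust the carrier of \<open>d\<close>: the regions where they exceed 1 increase to
  it. Truncating them suitably gives an increasing sequence of elements of \<open>E \<inter> [0, f]\<close>, the
  ramps, each of which is already equal to \<open>f\<close> where its predecessor is nonzero. Consequently the
  increments of this sequence, the bumps, live on layers of which only neighbours overlap: the
  bumps with even index are pairwise disjoint, and so are those with odd index. Starting from a
  maximal disjoint set of elements \<open>d\<close> of \<open>E\<^sub>+\<close>, all even bumps of all \<open>d\<close> together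
  still form a disjoint set, bounded by \<open>f\<close>, so the hypothesis bounds it in \<open>H\<close>; likewise the
  odd ones. The sum \<open>h\<close> of the two bounds dominates every ramp
  (\<open>ramp_le_of_bumps_le\<close>), which forces the positive part of \<open>f - h\<close> to be disjoint from every
  \<open>d\<close> (\<open>remainder_disjoint_of_ramp_le\<close>). For \<open>e \<in> E \<inter> [0, f]\<close> the positive part of \<open>e - h\<close>
  is then an element of \<open>E\<close> disjoint from the whole maximal set, so it vanishes, and \<open>e \<le> h\<close>.

  If \<open>E\<close> is generated by a sequence \<open>g\<close>, the maximal disjoint set can be replaced by the single
  sequence \<open>2\<^sup>n (\<bar>g\<^sub>0\<bar> + \<dots> + \<bar>g\<^sub>n\<bar>)\<close>. It produces countably many bumps, so bounds
  for countable disjoint sets are enough. The locale \<open>doubling_family\<close> treats both cases together.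
\<close>

section \<open>Disjointness in lattice-ordered groups\<close>

lemma lattice_group_inf_sup_distrib:
  fixes a b c :: "'a::lattice_ab_group_add"
  shows "inf a (sup b c) = sup (inf a b) (inf a c)"
proof (rule order.antisym)
  (* Translating sup b c by the nonpositive d brings it down to the left-hand side, and
     translation commutes with sup. *)
  define d where "d = inf a (sup b c) - sup b c"
  have d: "d \<le> 0" "d + sup b c \<le> a"
    unfolding d_def by (simp_all only: diff_le_0_iff_le diff_add_cancel inf_le1 inf_le2)
  have "d + b \<le> inf a b" "d + c \<le> inf a c"
    using d order_trans[OF add_left_mono[OF sup_ge1, of d b c] d(2)]
      order_trans[OF add_left_mono[OF sup_ge2, of d c b] d(2)]
    by simp_all
  then have "sup (d + b) (d + c) \<le> sup (inf a b) (inf a c)" by (rule sup_mono)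
  then show "inf a (sup b c) \<le> sup (inf a b) (inf a c)"
    by (simp only: d_def diff_add_cancel flip: add_sup_distrib_left)
qed (simp add: le_infI1 le_infI2)

lemma pprt_inf_distrib:
  fixes a b :: "'a::lattice_ab_group_add"
  shows "inf (pprt a) (pprt b) = pprt (inf a b)"
  using distrib_imp1[OF lattice_group_inf_sup_distrib, of 0 a b]
  by (simp add: pprt_def sup_commute)

lemma inf_pprt_pprt_uminus:
  fixes a :: "'a::lattice_ab_group_add"
  shows "inf (pprt a) (pprt (- a)) = 0"
proof -
  have "inf (pprt a) (pprt (- a)) \<le> pprt 0"
    unfolding pprt_inf_distrib
  proof (intro pprt_mono)
    have "inf a (- a) \<le> - inf a (- a)"
      by (simp add: neg_inf_eq_sup le_infI1 le_supI2)
    then show "inf a (- a) \<le> 0" by (simp only: le_minus_self_iff)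
  qed
  then show ?thesis by (simp add: order.antisym)
qed

lemma disjoint_mono:
  fixes x y x' y' :: "'a::lattice_ab_group_add"
  assumes "inf x' y' = 0" "0 \<le> x" "x \<le> x'" "0 \<le> y" "y \<le> y'"
  shows "inf x y = 0"
  using inf_mono[OF assms(3,5)] assms by (intro order.antisym) simp_all

lemma disjoint_add:
  fixes x y z :: "'a::lattice_ab_group_add"
  assumes xy: "inf x y = 0" and xz: "inf x z = 0" 
  shows "inf x (y + z) = 0"
proof (rule order.antisym)
  have nn: "0 \<le> x" "0 \<le> y" "0 \<le> z"
    using xy xz by (metis inf.cobounded1 inf.cobounded2)+
  define w where "w = inf x (y + z)"
  have w: "w \<le> x" "w \<le> y + z" by (simp_all add: w_def)
  have "w - y \<le> inf x z"
    using w nn order_trans[OF w(1), of "x + y"] by (simp add: diff_le_eq add.commute)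
  then have "w \<le> inf x y" using w xz by simp
  then show "w \<le> 0" using xy by simp
  show "0 \<le> inf x (y + z)" using nn by simp
qed

lemma disjoint_scaleR:
  fixes x y :: "'a::{ordered_real_vector, lattice_ab_group_add_abs}"
  assumes xy: "inf x y = 0" and c: "0 \<le> c"
  shows "inf x (c *\<^sub>R y) = 0"
proof -
  have nn: "0 \<le> x" "0 \<le> y" using xy by (metis inf.cobounded1 inf.cobounded2)+
  have mult: "inf x (real n *\<^sub>R y) = 0" for n
    by (induction n) (use nn xy in \<open>simp_all add: disjoint_add scaleR_left_distrib inf_absorb2\<close>)
  obtain n where "c \<le> real n" using real_arch_simple by blast
  then show ?thesis
    using disjoint_mono[OF mult[of n]] nn c by (simp add: scaleR_right_mono scaleR_nonneg_nonneg)
qed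

lemma disjoint_sum:
  fixes g :: "'i \<Rightarrow> 'a::lattice_ab_group_add"
  assumes "0 \<le> x" "\<And>i. i \<in> I \<Longrightarrow> inf x (g i) = 0"
  shows "inf x (sum g I) = 0"
  using assms(2)
  by (induction I rule: infinite_finite_induct) (use assms(1) in \<open>simp_all add: disjoint_add inf_absorb2\<close>)

text \<open>For disjoint positive elements the sum is the supremum, so a common upper bound survives summation.\<close>

lemma sum_disjoint_le:
  fixes g :: "'i \<Rightarrow> 'a::lattice_ab_group_add"
  assumes "finite I" "0 \<le> h"
    and "\<And>i. i \<in> I \<Longrightarrow> 0 \<le> g i" "\<And>i. i \<in> I \<Longrightarrow> g i \<le> h"
    and "\<And>i j. i \<in> I \<Longrightarrow> j \<in> I \<Longrightarrow> i \<noteq> j \<Longrightarrow> inf (g i) (g j) = 0"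
  shows "sum g I \<le> h"
  using assms
proof (induction I)
  case (insert i I)
  have "inf (g i) (sum g I) = 0"
  proof (rule disjoint_sum)
    show "inf (g i) (g j) = 0" if "j \<in> I" for j
      using that insert.hyps(2) insert.prems(4)[of i j] by auto
  qed (use insert.prems in simp)
  then have "g i + sum g I = sup (g i) (sum g I)"
    using add_eq_inf_sup[of "g i" "sum g I"] by simp
  moreover have "sum g I \<le> h" using insert by simp
  ultimately show ?case using insert by simp
qed simp

text \<open>Being an ideal is used twice: for the subspace structure of \<open>H\<^sup>d\<close>, and because an element disjoint
  from a set of generators is therefore disjoint from the ideal that they generate.\<close>

lemma vl_ideal_disjoint_complement:
  fixes G :: "'a::{ordered_real_vector, lattice_ab_group_add_abs} set"
  shows "vl_ideal (disjoint_complement G)"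
  unfolding vl_ideal_def
proof (intro conjI ballI allI impI)
  have dom: "f \<in> disjoint_complement G"
    if "\<And>g. g \<in> G \<Longrightarrow> inf \<bar>g\<bar> e = 0" "\<bar>f\<bar> \<le> e" for e f
  proof -
    have "inf \<bar>g\<bar> \<bar>f\<bar> = 0" if "g \<in> G" for g
      by (rule disjoint_mono[OF \<open>\<And>g. g \<in> G \<Longrightarrow> inf \<bar>g\<bar> e = 0\<close>[OF that]]) (simp_all add: \<open>\<bar>f\<bar> \<le> e\<close>)
    then have "inf \<bar>f\<bar> \<bar>g\<bar> = 0" if "g \<in> G" for g
      using that by (subst inf_commute) blast
    then show ?thesis by (simp add: disjoint_complement_def)
  qed
  have disj: "inf \<bar>g\<bar> \<bar>f\<bar> = 0" if "f \<in> disjoint_complement G" "g \<in> G" for f g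
    using that by (subst inf_commute) (simp add: disjoint_complement_def)
  show "f \<in> disjoint_complement G" if "e \<in> disjoint_complement G" "\<bar>f\<bar> \<le> \<bar>e\<bar>" for e f
    by (rule dom[where e = "\<bar>e\<bar>"]) (simp_all add: that disj)
  show "subspace (disjoint_complement G)"
  proof (rule subspaceI)
    show "0 \<in> disjoint_complement G"
      by (rule dom[where e = 0]) (simp_all add: inf_absorb2)
    show "x + y \<in> disjoint_complement G"
      if "x \<in> disjoint_complement G" "y \<in> disjoint_complement G" for x y
      by (rule dom[where e = "\<bar>x\<bar> + \<bar>y\<bar>"]) (simp_all add: that disj disjoint_add abs_triangle_ineq)
    show "c *\<^sub>R x \<in> disjoint_complement G" if "x \<in> disjoint_complement G" for c x
    proof (rule dom)
      show "inf \<bar>g\<bar> (\<bar>c\<bar> *\<^sub>R \<bar>x\<bar>) = 0" if "g \<in> G" for g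
        using disjoint_scaleR[OF disj] \<open>x \<in> _\<close> that by simp
      have "c *\<^sub>R x \<le> \<bar>c\<bar> *\<^sub>R \<bar>x\<bar>" for c
      proof (cases "0 \<le> c")
        case False
        then have "(- c) *\<^sub>R (- x) \<le> (- c) *\<^sub>R \<bar>x\<bar>"
          by (intro scaleR_left_mono abs_ge_minus_self) simp
        then show ?thesis using False by simp
      qed (simp add: scaleR_left_mono abs_ge_self)
      from this[of c] this[of "- c"] show "\<bar>c *\<^sub>R x\<bar> \<le> \<bar>c\<bar> *\<^sub>R \<bar>x\<bar>"
        by (intro abs_leI) simp_all
    qed
  qed
qed

section \<open>Ramps, bumps and doubling sequences\<close>

text \<open>In the function picture with \<open>f = 1\<close>, this is \<open>a\<close> followed by the piecewise linear map that
  vanishes up to \<open>1/2\<close>, rises with slope 2, and stays at 1 from \<open>1\<close> on. Hence if \<open>b \<ge> 2 a\<close>,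
  then \<open>ramp f b\<close> has reached \<open>f\<close> wherever \<open>ramp f a\<close> is nonzero.\<close>

definition ramp :: "'a::lattice_ab_group_add \<Rightarrow> 'a \<Rightarrow> 'a" where
  "ramp f a = inf (pprt (a + a - f)) f"

fun bump :: "'a::lattice_ab_group_add \<Rightarrow> (nat \<Rightarrow> 'a) \<Rightarrow> nat \<Rightarrow> 'a" where
  "bump f a 0 = ramp f (a 0)"
| "bump f a (Suc n) = ramp f (a (Suc n)) - ramp f (a n)"

lemma sum_bump: "(\<Sum>i\<le>n. bump f a i) = ramp f (a n)"
  by (induction n) simp_all

definition doubling :: "(nat \<Rightarrow> 'a::lattice_ab_group_add) \<Rightarrow> bool" where
  "doubling a \<longleftrightarrow> 0 \<le> a 0 \<and> (\<forall>n. a n + a n \<le> a (Suc n))"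

lemma doubling_nonneg: "doubling a \<Longrightarrow> 0 \<le> a n"
proof (induction n)
  case (Suc n)
  then have "0 \<le> a n + a n" by simp
  also have "\<dots> \<le> a (Suc n)" using Suc.prems by (simp add: doubling_def)
  finally show ?case .
qed (simp add: doubling_def)

lemma doubling_mono:
  assumes "doubling a" "m \<le> n"
  shows "a m \<le> a n"
proof (rule lift_Suc_mono_le[OF _ assms(2)])
  fix n
  have "a n \<le> a n + a n" using doubling_nonneg[OF assms(1)] by simp
  also have "\<dots> \<le> a (Suc n)" using assms(1) by (simp add: doubling_def)
  finally show "a n \<le> a (Suc n)" .
qed

lemma ramp_nonneg: "0 \<le> f \<Longrightarrow> 0 \<le> ramp f a"
  by (simp add: ramp_def)

lemma ramp_le: "ramp f a \<le> f"
  by (simp add: ramp_def)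

lemma ramp_mono: "a \<le> b \<Longrightarrow> ramp f a \<le> ramp f b"
  unfolding ramp_def by (intro inf_mono pprt_mono diff_right_mono add_mono) auto

lemma ramp_le_double:
  assumes "0 \<le> f" "0 \<le> a"
  shows "ramp f a \<le> a + a"
proof -
  have "pprt (a + a - f) \<le> a + a"
    using assms by (simp add: pprt_def diff_le_eq)
  then show ?thesis by (simp add: ramp_def le_infI1)
qed

text \<open>The two factors live where \<open>b > f\<close> and where \<open>b < f\<close>: the first is at most \<open>pprt (b - f)\<close> and
  the second at most \<open>2 pprt (f - b)\<close>.\<close>

lemma ramp_disjoint_gap:
  assumes f: "0 \<le> f" and ab: "a + a \<le> b"
  shows "inf (ramp f a) (f - ramp f b) = 0"
proof (rule disjoint_mono)
  let ?q = "pprt (f - b)"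
  have "inf (pprt (b - f)) ?q = 0"
    using inf_pprt_pprt_uminus[of "b - f"] by simp
  then show "inf (pprt (b - f)) (?q + ?q) = 0" by (simp add: disjoint_add)
  show "ramp f a \<le> pprt (b - f)"
    using ab by (auto simp: ramp_def intro!: le_infI1 pprt_mono diff_right_mono)
  have "f - b \<le> ?q" "0 \<le> ?q" by (simp_all add: pprt_def)
  then have "(f - b) + (f - b) \<le> ?q + ?q" "0 \<le> ?q + ?q" by (simp_all add: add_mono)
  then have "f - (?q + ?q) \<le> b + b - f" "f - (?q + ?q) \<le> f"
    by (simp_all add: algebra_simps)
  moreover have "b + b - f \<le> pprt (b + b - f)" by (simp add: pprt_def)
  ultimately have "f - (?q + ?q) \<le> ramp f b"
    unfolding ramp_def by (auto intro: order_trans)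
  then show "f - ramp f b \<le> ?q + ?q" by (simp add: algebra_simps)
qed (use f in \<open>simp_all add: ramp_nonneg ramp_le\<close>)

lemma bump_nonneg: "0 \<le> f \<Longrightarrow> doubling a \<Longrightarrow> 0 \<le> bump f a n"
  by (cases n) (simp_all add: ramp_nonneg ramp_mono doubling_mono)

lemma bump_le_ramp: "0 \<le> f \<Longrightarrow> bump f a n \<le> ramp f (a n)"
  by (cases n) (simp_all add: ramp_nonneg)

text \<open>With a gap of at least two between the indices, the later bump is an increment on top of
  \<open>ramp f (a (Suc n))\<close>, so it fits under \<open>f - ramp f (a (Suc n))\<close>, which \<open>ramp f (a n)\<close> does not meet.\<close>

lemma bump_disjoint_later:
  assumes f: "0 \<le> f" and a: "doubling a" and nm: "n + 2 \<le> m"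
  shows "inf (bump f a n) (bump f a m) = 0"
proof (rule disjoint_mono[OF ramp_disjoint_gap[OF f]])
  obtain k where k: "m = Suc k" "Suc n \<le> k" using nm by (cases m) auto
  show "a n + a n \<le> a (Suc n)" using a by (simp add: doubling_def)
  have "ramp f (a (Suc n)) \<le> ramp f (a k)" by (intro ramp_mono doubling_mono a k)
  then show "bump f a m \<le> f - ramp f (a (Suc n))"
    using ramp_le[of f "a (Suc k)"] by (simp add: k diff_mono)
qed (use f a in \<open>simp_all add: bump_nonneg bump_le_ramp\<close>)

lemma bump_disjoint_same_parity:
  assumes "0 \<le> f" "doubling a" "even n = even m" "n \<noteq> m"
  shows "inf (bump f a n) (bump f a m) = 0"
proof -
  have "n + 2 \<le> m \<or> m + 2 \<le> n" using assms(3,4) by presburger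
  then show ?thesis
    using bump_disjoint_later[OF assms(1,2)] by (metis inf_commute)
qed

text \<open>A ramp is the telescoping sum of its bumps; split by parity, it becomes two disjoint sums, each
  controlled by its own bound.\<close>

lemma ramp_le_of_bumps_le:
  assumes f: "0 \<le> f" and a: "doubling a" and h: "0 \<le> h0" "0 \<le> h1"
    and even: "\<And>n. even n \<Longrightarrow> bump f a n \<le> h0" and odd: "\<And>n. odd n \<Longrightarrow> bump f a n \<le> h1"
  shows "ramp f (a n) \<le> h0 + h1"
proof -
  have "(\<Sum>i\<le>n. bump f a i) = (\<Sum>i\<in>{i. i \<le> n \<and> even i}. bump f a i) + (\<Sum>i\<in>{i. i \<le> n \<and> odd i}. bump f a i)"
    by (subst sum.union_disjoint[symmetric]) (auto intro!: sum.cong)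
  also have "\<dots> \<le> h0 + h1"
    by (intro add_mono sum_disjoint_le) (use assms in \<open>auto intro!: bump_disjoint_same_parity bump_nonneg\<close>)
  finally show ?thesis by (simp add: sum_bump)
qed

text \<open>Where \<open>h < f\<close>, a truncation of \<open>2 a\<^sub>n - f\<close> at \<open>f\<close> that stays below \<open>h\<close> is not truncated by \<open>f\<close> at
  all, so \<open>2 a\<^sub>n \<le> f + h\<close> there for every \<open>n\<close>. Since \<open>a\<close> grows at least geometrically, the
  Archimedean property leaves no room for a common part of \<open>a k\<close> and this region.\<close>

lemma remainder_disjoint_of_ramp_le:
  fixes a :: "nat \<Rightarrow> 'a::archimedean_vector_lattice"
  assumes f: "0 \<le> f" and h: "0 \<le> h" and a: "doubling a" and le: "\<And>n. ramp f (a n) \<le> h"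
  shows "inf (pprt (f - h)) (a k) = 0"
proof -
  define y where "y = inf (pprt (f - h)) (a k)"
  have y: "0 \<le> y" "y \<le> pprt (f - h)" "y \<le> a k"
    using doubling_nonneg[OF a] by (simp_all add: y_def)
  have grow: "real N *\<^sub>R y \<le> a (k + N)" for N
  proof (induction N)
    case (Suc N)
    have "real (Suc N) *\<^sub>R y = y + real N *\<^sub>R y" by (simp add: scaleR_left_distrib)
    also have "\<dots> \<le> a (k + N) + a (k + N)"
      using Suc y(3) doubling_mono[OF a, of k "k + N"] by (intro add_mono) auto
    also have "\<dots> \<le> a (k + Suc N)" using a by (simp add: doubling_def)
    finally show ?case .
  qed (use doubling_nonneg[OF a] in simp)
  have "real N *\<^sub>R y \<le> f + h" for N
  proof -
    define z where "z = real N *\<^sub>R y"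
    define b where "b = a (k + N)"
    have z: "0 \<le> z" "z \<le> b + b"
      using y grow[of N] doubling_nonneg[OF a, of "k + N"] add_increasing[of b z b]
      by (simp_all add: z_def b_def scaleR_nonneg_nonneg)
    have "inf (f - h) (b + b - f - h) \<le> 0"
    proof -
      have "inf (f - h) (b + b - f - h) = inf f (b + b - f) - h"
        by (simp add: add_inf_distrib_right diff_conv_add_uminus del: add_uminus_conv_diff)
      also have "inf f (b + b - f) \<le> ramp f b"
        unfolding ramp_def by (simp add: le_infI2 pprt_def)
      finally show ?thesis
        using order_trans[OF _ diff_right_mono[OF le[of "k + N"], of h]] by (simp add: b_def)
    qed
    then have "inf (pprt (f - h)) (pprt (b + b - f - h)) = 0"
      by (simp add: pprt_inf_distrib)
    (* The part of z above f + h is disjoint from y, hence from its multiple z; but it lies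
       below z, so it vanishes. *)
    then have "inf y (pprt (z - (f + h))) = 0"
      by (rule disjoint_mono) (use y z in \<open>auto intro!: pprt_mono simp: algebra_simps\<close>)
    then have "inf (pprt (z - (f + h))) z = 0"
      unfolding z_def by (intro disjoint_scaleR) (simp_all add: inf_commute)
    moreover have "pprt (z - (f + h)) \<le> z"
      using z f h by (simp add: pprt_def diff_le_eq)
    ultimately have "pprt (z - (f + h)) = 0" by (simp add: inf_absorb1)
    then show ?thesis unfolding z_def by (simp flip: le_zero_iff_zero_pprt)
  qed
  then have "y \<le> 0" by (rule archimedean)
  then show ?thesis using y by (simp add: y_def order.antisym)
qed


section \<open>Doubling families\<close>

definition bump_family :: "'a::lattice_ab_group_add \<Rightarrow> 'i set \<Rightarrow> ('i \<Rightarrow> nat \<Rightarrow> 'a) \<Rightarrow> bool \<Rightarrow> 'a set" where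
  "bump_family f D a b = {bump f (a i) n | i n. i \<in> D \<and> even n = b}"

text \<open>Mutually disjoint doubling sequences in \<open>E\<close> that together are large: no nonzero positive element
  of \<open>E\<close> is disjoint from all of them. This is what remains of a maximal disjoint set, or of a set of
  generators, once its elements have been turned into sequences with exhausting ramps.\<close>

locale doubling_family =
  fixes E :: "'a::archimedean_vector_lattice set" and D :: "'i set" and a :: "'i \<Rightarrow> nat \<Rightarrow> 'a"
  assumes ideal: "vl_ideal E"
    and doubling: "i \<in> D \<Longrightarrow> doubling (a i)"
    and mem: "i \<in> D \<Longrightarrow> a i n \<in> E"
    and disjoint: "i \<in> D \<Longrightarrow> j \<in> D \<Longrightarrow> i \<noteq> j \<Longrightarrow> inf (a i m) (a j n) = 0"
    and total: "x \<in> E \<Longrightarrow> 0 \<le> x \<Longrightarrow> (\<And>i n. i \<in> D \<Longrightarrow> inf x (a i n) = 0) \<Longrightarrow> x = 0"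
begin

lemma bump_le:
  assumes "0 \<le> f" "i \<in> D"
  shows "bump f (a i) n \<le> a i n + a i n"
  using bump_le_ramp[OF assms(1)] ramp_le_double[OF assms(1) doubling_nonneg[OF doubling[OF assms(2)]]]
  by (rule order_trans)

lemma bump_family_positive:
  assumes f: "0 \<le> f"
  shows "bump_family f D a b \<subseteq> positive_part E"
proof -
  have "bump f (a i) n \<in> E" if i: "i \<in> D" for i n
  proof -
    have "a i n + a i n \<in> E"
      using ideal mem[OF i] by (auto simp: vl_ideal_def subspace_add)
    moreover have "\<bar>bump f (a i) n\<bar> \<le> \<bar>a i n + a i n\<bar>"
      using bump_le[OF f i, of n] bump_nonneg[OF f doubling[OF i], of n]
      by (metis abs_of_nonneg order_trans)
    ultimately show ?thesis using ideal by (auto simp: vl_ideal_def)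
  qed
  then show ?thesis
    using f doubling by (auto simp: bump_family_def positive_part_def bump_nonneg)
qed

lemma bump_family_disjoint:
  assumes f: "0 \<le> f"
  shows "disjoint_elements (bump_family f D a b)"
  unfolding disjoint_elements_def
proof (rule pairwiseI)
  fix x y
  assume "x \<in> bump_family f D a b" "y \<in> bump_family f D a b" and neq: "x \<noteq> y"
  then obtain i j m n where x: "x = bump f (a i) m" "i \<in> D" "even m = b"
    and y: "y = bump f (a j) n" "j \<in> D" "even n = b"
    by (auto simp: bump_family_def)
  have nn: "0 \<le> x" "0 \<le> y" using x y f doubling by (simp_all add: bump_nonneg)
  have "inf x y = 0"
  proof (cases "i = j")
    case True
    then show ?thesis
      using x y neq f doubling by (auto intro!: bump_disjoint_same_parity)
  next
    case False
    have 1: "inf (a i m) (a j n + a j n) = 0"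
      using disjoint[OF x(2) y(2) False] by (simp add: disjoint_add)
    have "inf (a i m + a i m) (a j n + a j n) = 0"
      using disjoint_add[of "a j n + a j n" "a i m" "a i m"] 1 by (simp add: inf_commute)
    then show ?thesis
      by (rule disjoint_mono) (use nn x y f in \<open>simp_all add: bump_le\<close>)
  qed
  then show "inf \<bar>x\<bar> \<bar>y\<bar> = 0" using nn by simp
qed

lemma bump_family_bounded:
  assumes f: "0 \<le> f"
  shows "order_bounded_in (bump_family f D a b) UNIV"
  unfolding order_bounded_in_def
proof (intro bexI[of _ f] ballI)
  show "g \<le> f" if "g \<in> bump_family f D a b" for g
    using that order_trans[OF bump_le_ramp[OF f] ramp_le] by (auto simp: bump_family_def)
qed simp

lemma countable_bump_family:
  assumes "countable D"
  shows "countable (bump_family f D a b)"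
proof -
  have "bump_family f D a b \<subseteq> (\<lambda>(i, n). bump f (a i) n) ` (D \<times> UNIV)"
    by (auto simp: bump_family_def)
  then show ?thesis
    using assms by (meson countable_SIGMA countable_image countable_subset countableI_type)
qed

text \<open>This is where bounds for disjoint sets become a bound for a whole interval of \<open>E\<close>. The absolute
  value of a bound is taken because a bound of an empty family need not be positive.\<close>

lemma interval_bounded:
  assumes H: "vl_ideal H" and f: "0 \<le> f"
    and bdd: "\<And>b. order_bounded_in (bump_family f D a b) H"
  shows "\<exists>h\<in>H. \<forall>e\<in>E. 0 \<le> e \<longrightarrow> e \<le> f \<longrightarrow> e \<le> h"
proof -
  have "\<exists>h\<in>H. 0 \<le> h \<and> (\<forall>g\<in>bump_family f D a b. g \<le> h)" for b
  proof -
    obtain h where h: "h \<in> H" "\<forall>g\<in>bump_family f D a b. g \<le> h"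
      using bdd[of b] by (auto simp: order_bounded_in_def)
    have "\<bar>h\<bar> \<in> H" using H h(1) by (auto simp: vl_ideal_def)
    then show ?thesis using h abs_ge_self[of h] by (meson abs_ge_zero order_trans)
  qed
  then obtain h where h: "\<And>b. h b \<in> H" "\<And>b. 0 \<le> h b"
    and le: "\<And>b g. g \<in> bump_family f D a b \<Longrightarrow> g \<le> h b"
    by metis
  define k where "k = h True + h False"
  have k: "k \<in> H" "0 \<le> k" using h H by (auto simp: k_def vl_ideal_def subspace_add)
  have ramp: "ramp f (a i n) \<le> k" if "i \<in> D" for i n
    unfolding k_def
  proof (rule ramp_le_of_bumps_le[OF f doubling[OF that] h(2) h(2)])
    show "bump f (a i) n \<le> h True" if "even n" for n
      using that \<open>i \<in> D\<close> by (intro le) (auto simp: bump_family_def)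
    show "bump f (a i) n \<le> h False" if "odd n" for n
      using that \<open>i \<in> D\<close> by (intro le) (auto simp: bump_family_def)
  qed
  have "e \<le> k" if e: "e \<in> E" "0 \<le> e" "e \<le> f" for e
  proof -
    have "pprt (e - k) = 0"
    proof (rule total)
      have "pprt (e - k) \<le> e" using e k by (simp add: pprt_def diff_le_eq)
      then have "\<bar>pprt (e - k)\<bar> \<le> \<bar>e\<bar>" using e by simp
      then show "pprt (e - k) \<in> E" using ideal e by (auto simp: vl_ideal_def)
      show "inf (pprt (e - k)) (a i n) = 0" if "i \<in> D" for i n
        by (rule disjoint_mono[OF remainder_disjoint_of_ramp_le[OF f k(2) doubling[OF that] ramp[OF that]]])
          (use e doubling[OF that] in \<open>auto intro!: pprt_mono diff_right_mono doubling_nonneg\<close>)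
    qed simp
    then show ?thesis by (simp flip: le_zero_iff_zero_pprt)
  qed
  then show ?thesis using k by blast
qed

end

section \<open>Existence of doubling families\<close>

lemma exists_maximal_disjoint:
  fixes E :: "'a::{ordered_real_vector, lattice_ab_group_add_abs} set"
  shows "\<exists>D\<subseteq>positive_part E. disjoint_elements D \<and>
    (\<forall>x\<in>E. 0 \<le> x \<longrightarrow> (\<forall>d\<in>D. inf x d = 0) \<longrightarrow> x = 0)"
proof -
  let ?A = "{D. D \<subseteq> positive_part E \<and> disjoint_elements D}"
  have "\<exists>D\<in>?A. \<forall>X\<in>?A. D \<subseteq> X \<longrightarrow> X = D"
  proof (rule subset_Zorn')
    fix C assume "subset.chain ?A C"
    then show "\<Union>C \<in> ?A"
      unfolding subset_chain_def disjoint_elements_def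
      by (auto intro!: pairwise_chain_Union simp: chain_subset_def)
  qed
  then obtain D where D: "D \<subseteq> positive_part E" "disjoint_elements D"
    and max: "\<And>X. X \<subseteq> positive_part E \<Longrightarrow> disjoint_elements X \<Longrightarrow> D \<subseteq> X \<Longrightarrow> X = D"
    by auto
  have "x = 0" if x: "x \<in> E" "0 \<le> x" and xD: "\<And>d. d \<in> D \<Longrightarrow> inf x d = 0" for x
  proof -
    have "inf \<bar>x\<bar> \<bar>d\<bar> = 0" if "d \<in> D" for d
      using xD[OF that] x D(1) that by (auto simp: positive_part_def)
    moreover from this have "inf \<bar>d\<bar> \<bar>x\<bar> = 0" if "d \<in> D" for d
      using that by (subst inf_commute)
    ultimately have "disjoint_elements (insert x D)"
      using D(2) by (simp add: disjoint_elements_def pairwise_insert)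
    then have "x \<in> D" using max[of "insert x D"] x D(1) by (auto simp: positive_part_def)
    from xD[OF this] show ?thesis by simp
  qed
  then show ?thesis using D by (intro exI[of _ D]) simp
qed

lemma doubling_power_scaleR:
  fixes s :: "nat \<Rightarrow> 'a::{ordered_real_vector, lattice_ab_group_add_abs}"
  assumes "0 \<le> s 0" "\<And>n. s n \<le> s (Suc n)"
  shows "doubling (\<lambda>n. 2 ^ n *\<^sub>R s n)"
  unfolding doubling_def
proof (intro conjI allI)
  fix n
  have "(2::real) ^ n *\<^sub>R s n + 2 ^ n *\<^sub>R s n = 2 ^ Suc n *\<^sub>R s n"
    by (simp flip: scaleR_left_distrib)
  also have "\<dots> \<le> 2 ^ Suc n *\<^sub>R s (Suc n)" using assms(2) by (intro scaleR_left_mono) auto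
  finally show "(2::real) ^ n *\<^sub>R s n + 2 ^ n *\<^sub>R s n \<le> 2 ^ Suc n *\<^sub>R s (Suc n)" .
qed (use assms(1) in simp)

lemma exists_doubling_family:
  assumes E: "vl_ideal (E :: 'a::archimedean_vector_lattice set)"
  shows "\<exists>D. doubling_family E D (\<lambda>d n. 2 ^ n *\<^sub>R d)"
proof -
  obtain D where D: "D \<subseteq> positive_part E" "disjoint_elements D"
    and max: "\<forall>x\<in>E. 0 \<le> x \<longrightarrow> (\<forall>d\<in>D. inf x d = 0) \<longrightarrow> x = 0"
    using exists_maximal_disjoint[of E] by (elim exE conjE) (rule that)
  have pos: "d \<in> E" "0 \<le> d" if "d \<in> D" for d
    using D(1) that by (auto simp: positive_part_def)
  have "doubling_family E D (\<lambda>d n. 2 ^ n *\<^sub>R d)"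
  proof
    show "doubling (\<lambda>n. 2 ^ n *\<^sub>R d)" if "d \<in> D" for d
      using pos[OF that] by (intro doubling_power_scaleR) auto
    show "2 ^ n *\<^sub>R d \<in> E" if "d \<in> D" for d n
      using pos[OF that] E by (auto simp: vl_ideal_def subspace_scale)
    show "inf ((2::real) ^ m *\<^sub>R c) ((2::real) ^ n *\<^sub>R d) = 0" if "c \<in> D" "d \<in> D" "c \<noteq> d" for c d m n
    proof -
      have "inf c d = 0"
        using pairwiseD[OF D(2)[unfolded disjoint_elements_def] that] pos that by simp
      then have "inf c ((2::real) ^ n *\<^sub>R d) = 0" by (intro disjoint_scaleR) auto
      then show ?thesis
        using disjoint_scaleR[of "(2::real) ^ n *\<^sub>R d" c "2 ^ m"] by (simp add: inf_commute)
    qed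
    show "x = 0" if x: "x \<in> E" "0 \<le> x" and xD: "\<And>d n. d \<in> D \<Longrightarrow> inf x ((2::real) ^ n *\<^sub>R d) = 0" for x
    proof -
      have "inf x d = 0" if "d \<in> D" for d using xD[OF that, of 0] by simp
      then show ?thesis using max x by simp
    qed
  qed (rule E)
  then show ?thesis ..
qed

text \<open>Partial sums of the generators, rather than the generators themselves, provide one increasing
  sequence. The scaled sequence is total since an element disjoint from all generators is disjoint from
  the ideal that they generate, thus from itself if it belongs to that ideal.\<close>

lemma exists_countable_doubling_family:
  assumes E: "vl_ideal (E :: 'a::archimedean_vector_lattice set)" and gen: "countably_generated_ideal E"
  shows "\<exists>a. doubling_family E {()} a"
proof -
  obtain S where S: "countable S" "E = vl_ideal hull S"
    using gen by (auto simp: countably_generated_ideal_def)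
  (* The zero element keeps the enumerated set nonempty. *)
  define g where "g = from_nat_into (insert 0 S)"
  have g: "range g = insert 0 S"
    unfolding g_def using S(1) by (intro range_from_nat_into) auto
  have sub: "subspace E" and solid: "\<And>e x. e \<in> E \<Longrightarrow> \<bar>x\<bar> \<le> \<bar>e\<bar> \<Longrightarrow> x \<in> E"
    using E by (auto simp: vl_ideal_def)
  have gE: "\<bar>g i\<bar> \<in> E" for i
  proof (rule solid)
    have "g i \<in> insert 0 S" using rangeI[of g i] unfolding g .
    moreover have "S \<subseteq> E" unfolding S(2) by (rule hull_subset)
    ultimately show "g i \<in> E" using subspace_0[OF sub] by (elim insertE) (simp_all add: subsetD)
  qed simp
  define s where "s n = (\<Sum>i\<le>n. \<bar>g i\<bar>)" for n
  define a where "a = (\<lambda>_::unit. \<lambda>n. 2 ^ n *\<^sub>R s n)"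
  have s: "0 \<le> s n" "\<bar>g n\<bar> \<le> s n" "s n \<in> E" for n
    unfolding s_def
    using sum_mono2[of "{..n}" "{n}" "\<lambda>i. \<bar>g i\<bar>"]
    by (simp_all add: sum_nonneg subspace_sum[OF sub] gE)
  have dbl: "doubling (a i)" for i
    unfolding a_def by (rule doubling_power_scaleR) (simp_all add: s_def)
  have "doubling_family E {()} a"
  proof
    show "a i n \<in> E" for i n unfolding a_def by (rule subspace_scale[OF sub s(3)])
    show "x = 0" if x: "x \<in> E" "0 \<le> x" and xa: "\<And>i n. i \<in> {()} \<Longrightarrow> inf x (a i n) = 0" for x
    proof -
      have "inf x \<bar>g n\<bar> = 0" for n
      proof (rule disjoint_mono[OF xa[OF singletonI]])
        have "s n \<le> 2 ^ n *\<^sub>R s n"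
          using scaleR_right_mono[OF one_le_power[of "2::real" n] s(1)[of n]] by simp
        then show "\<bar>g n\<bar> \<le> a () n" unfolding a_def by (rule order_trans[OF s(2)])
      qed (simp_all add: x(2))
      then have "inf \<bar>g n\<bar> \<bar>x\<bar> = 0" for n
        using x(2) by (subst inf_commute) simp
      then have "range g \<subseteq> disjoint_complement {x}"
        by (auto simp: disjoint_complement_def)
      then have "S \<subseteq> disjoint_complement {x}" using g by auto
      then have "E \<subseteq> disjoint_complement {x}"
        unfolding S(2) by (rule hull_minimal) (rule vl_ideal_disjoint_complement)
      then have "x \<in> disjoint_complement {x}" using x by blast
      then show ?thesis by (simp add: disjoint_complement_def)
    qed
  qed (simp_all add: E dbl)
  then show ?thesis by (rule exI[of _ a])
qed

section \<open>Projection bands\<close>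

text \<open>The \<open>H\<close>-component of \<open>f \<ge> 0\<close> is \<open>inf f h\<close>, for any \<open>h \<in> H\<close> above \<open>E \<inter> [0, f]\<close>. If an
  element \<open>e > 0\<close> of \<open>E\<close> were below the remainder, then \<open>n e \<le> inf f h\<close> would give
  \<open>(n + 1) e \<le> f\<close>, hence again \<open>(n + 1) e \<le> inf f h\<close>.\<close>

lemma projection_band_of_interval_bounded:
  fixes H :: "'a::archimedean_vector_lattice set"
  assumes H: "vl_ideal H" and E: "vl_ideal E" and dense: "order_dense_in E H"
    and bdd: "\<And>f. 0 \<le> f \<Longrightarrow> \<exists>h\<in>H. \<forall>e\<in>E. 0 \<le> e \<longrightarrow> e \<le> f \<longrightarrow> e \<le> h"
  shows "projection_band H"
proof -
  let ?C = "disjoint_complement H"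
  have subH: "subspace H" and subC: "subspace ?C"
    using H vl_ideal_disjoint_complement[of H] by (auto simp: vl_ideal_def)
  have solid: "\<And>h x. h \<in> H \<Longrightarrow> \<bar>x\<bar> \<le> \<bar>h\<bar> \<Longrightarrow> x \<in> H"
    using H by (auto simp: vl_ideal_def)
  have pos: "\<exists>h\<in>H. f - h \<in> ?C" if f: "0 \<le> f" for f
  proof -
    obtain h0 where h0: "h0 \<in> H" "\<And>e. e \<in> E \<Longrightarrow> 0 \<le> e \<Longrightarrow> e \<le> f \<Longrightarrow> e \<le> h0"
      using bdd[OF f] by blast
    have "0 \<le> h0" using h0(2)[of 0] E f by (simp add: vl_ideal_def subspace_0)
    define h where "h = inf f h0"
    have h: "0 \<le> h" "h \<le> f" "h \<le> h0" using f \<open>0 \<le> h0\<close> by (simp_all add: h_def)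
    have le_h: "e \<le> h" if "e \<in> E" "0 \<le> e" "e \<le> f" for e
      using h0(2)[OF that] that by (simp add: h_def)
    have hH: "h \<in> H" using h by (intro solid[OF h0(1)]) (metis abs_of_nonneg order_trans)
    have "f - h \<in> ?C"
      unfolding disjoint_complement_def
    proof (intro CollectI ballI, rule ccontr)
      fix u assume u: "u \<in> H" and ne: "inf \<bar>f - h\<bar> \<bar>u\<bar> \<noteq> 0"
      let ?w = "inf \<bar>f - h\<bar> \<bar>u\<bar>"
      have "0 \<le> ?w" by simp
      then have "0 < ?w" "?w \<in> H" using ne solid[OF u, of ?w] by (auto simp: less_le)
      then obtain e where e: "e \<in> E" "0 < e" "e \<le> ?w"
        using dense by (auto simp: order_dense_in_def)
      have e_le: "e \<le> f - h" using e(3) h by simp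
      have "real n *\<^sub>R e \<le> h" for n
      proof (induction n)
        case (Suc n)
        have "real (Suc n) *\<^sub>R e = e + real n *\<^sub>R e" by (simp add: scaleR_left_distrib)
        also have "\<dots> \<le> (f - h) + h" using e_le Suc by (rule add_mono)
        finally have "real (Suc n) *\<^sub>R e \<le> f" by simp
        moreover have "real (Suc n) *\<^sub>R e \<in> E" using e(1) E by (simp add: vl_ideal_def subspace_scale)
        moreover have "0 \<le> real (Suc n) *\<^sub>R e" using e(2) by (intro scaleR_nonneg_nonneg) auto
        ultimately show ?case by (intro le_h)
      qed (use h in simp)
      then have "e \<le> 0" by (rule archimedean)
      then show False using e(2) by simp
    qed
    then show ?thesis using hH by blast
  qed
  have "f \<in> {h + k | h k. h \<in> H \<and> k \<in> ?C}" for f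
  proof -
    obtain h1 h2 where h1: "h1 \<in> H" "pprt f - h1 \<in> ?C" and h2: "h2 \<in> H" "pprt (- f) - h2 \<in> ?C"
      using pos[of "pprt f"] pos[of "pprt (- f)"] by auto
    have "f = (h1 - h2) + ((pprt f - h1) - (pprt (- f) - h2))"
      using prts[of f] by (simp add: pprt_neg)
    moreover have "h1 - h2 \<in> H" "(pprt f - h1) - (pprt (- f) - h2) \<in> ?C"
      using h1 h2 subH subC by (simp_all add: subspace_diff)
    ultimately show ?thesis by blast
  qed
  then show ?thesis using H by (auto simp: projection_band_def)
qed

text \<open>From \<open>g \<le> \<bar>h\<bar> + \<bar>k\<bar>\<close> the part of \<open>g\<close> above \<open>\<bar>h\<bar>\<close> lies below both \<open>g\<close> and \<open>\<bar>k\<bar>\<close>,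
  which are disjoint.\<close>

lemma order_bounded_in_projection_band:
  assumes "projection_band H" and G: "G \<subseteq> positive_part H" "order_bounded_in G UNIV"
  shows "order_bounded_in G H"
proof -
  obtain f where f: "\<And>g. g \<in> G \<Longrightarrow> g \<le> f" using G(2) by (auto simp: order_bounded_in_def)
  obtain h k where hk: "f = h + k" "h \<in> H" "k \<in> disjoint_complement H"
    using assms(1) UNIV_I[of f] unfolding projection_band_def by blast
  have "g \<le> \<bar>h\<bar>" if g: "g \<in> G" for g
  proof -
    have nn: "g \<in> H" "0 \<le> g" using G(1) g by (auto simp: positive_part_def)
    have "inf \<bar>k\<bar> \<bar>g\<bar> = 0" using hk(3) nn(1) by (simp add: disjoint_complement_def)
    then have disj: "inf g \<bar>k\<bar> = 0" using nn(2) by (simp add: inf_commute)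
    have "g \<le> \<bar>h\<bar> + \<bar>k\<bar>"
      using f[OF g] hk(1) by (metis abs_ge_self add_mono order_trans)
    then have "pprt (g - \<bar>h\<bar>) \<le> inf g \<bar>k\<bar>"
      using nn by (simp add: pprt_def diff_le_eq add.commute)
    then show ?thesis unfolding disj by (simp add: pprt_def diff_le_eq)
  qed
  moreover have "\<bar>h\<bar> \<in> H" using assms(1) hk(2) by (auto simp: projection_band_def vl_ideal_def)
  ultimately show ?thesis by (auto simp: order_bounded_in_def)
qed

theorem theorem3p10:
  fixes H :: "'a::archimedean_vector_lattice set"
  assumes "vl_ideal H"
  shows
   "((projection_band H \<longleftrightarrow>
       (\<forall>G. G \<subseteq> positive_part H \<and> order_bounded_in G UNIV \<longrightarrow> order_bounded_in G H)) \<and>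
     (projection_band H \<longleftrightarrow>
       (\<forall>G. G \<subseteq> positive_part H \<and> disjoint_elements G \<and> order_bounded_in G UNIV
          \<longrightarrow> order_bounded_in G H)) \<and>
     (projection_band H \<longleftrightarrow>
       (\<exists>E. vl_ideal E \<and> E \<subseteq> H \<and> order_dense_in E H \<and>
          (\<forall>G. G \<subseteq> positive_part E \<and> disjoint_elements G \<and> order_bounded_in G UNIV
             \<longrightarrow> order_bounded_in G H)))) \<and>
    ((\<exists>E. vl_ideal E \<and> countably_generated_ideal E \<and> E \<subseteq> H \<and> order_dense_in E H \<and>
        (\<forall>G. G \<subseteq> positive_part E \<and> countable G \<and> disjoint_elements G \<and> order_bounded_in G UNIV
           \<longrightarrow> order_bounded_in G H))
      \<longrightarrow> projection_band H)"
proof -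
  have bounded_imp: "projection_band H"
    if E: "vl_ideal E" "order_dense_in E H"
      and bdd: "\<And>G. G \<subseteq> positive_part E \<Longrightarrow> disjoint_elements G \<Longrightarrow> order_bounded_in G UNIV \<Longrightarrow> order_bounded_in G H"
    for E
  proof -
    obtain D where "doubling_family E D (\<lambda>d n. 2 ^ n *\<^sub>R d)"
      using exists_doubling_family[OF E(1)] by blast
    then interpret doubling_family E D "\<lambda>d n. 2 ^ n *\<^sub>R d" .
    show ?thesis
      by (intro projection_band_of_interval_bounded[OF assms E] interval_bounded[OF assms] bdd
          bump_family_positive bump_family_disjoint bump_family_bounded)
  qed
  have countable_imp: "projection_band H"
    if E: "vl_ideal E" "order_dense_in E H" "countably_generated_ideal E"
      and bdd: "\<And>G. G \<subseteq> positive_part E \<Longrightarrow> countable G \<Longrightarrow> disjoint_elements G \<Longrightarrow> order_bounded_in G UNIV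
        \<Longrightarrow> order_bounded_in G H"
    for E
  proof -
    obtain a where "doubling_family E {()} a"
      using exists_countable_doubling_family[OF E(1,3)] by blast
    then interpret doubling_family E "{()}" a .
    show ?thesis
      by (intro projection_band_of_interval_bounded[OF assms E(1,2)] interval_bounded[OF assms] bdd
          bump_family_positive bump_family_disjoint bump_family_bounded countable_bump_family) simp_all
  qed
  have dense: "order_dense_in H H"
    using vl_ideal_imp_vl_sublattice[OF assms] by (auto simp: order_dense_in_def)
  show ?thesis
  proof (intro conjI iffI impI allI)
    show "order_bounded_in G H"
      if "projection_band H" "G \<subseteq> positive_part H \<and> order_bounded_in G UNIV" for G
      using order_bounded_in_projection_band[OF that(1)] that(2) by simp
    show "order_bounded_in G H"
      if "projection_band H" "G \<subseteq> positive_part H \<and> disjoint_elements G \<and> order_bounded_in G UNIV" for G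
      using order_bounded_in_projection_band[OF that(1)] that(2) by simp
    show "projection_band H"
      if "\<forall>G. G \<subseteq> positive_part H \<and> order_bounded_in G UNIV \<longrightarrow> order_bounded_in G H"
      by (rule bounded_imp[OF assms dense]) (simp add: that)
    show "projection_band H"
      if "\<forall>G. G \<subseteq> positive_part H \<and> disjoint_elements G \<and> order_bounded_in G UNIV
          \<longrightarrow> order_bounded_in G H"
      by (rule bounded_imp[OF assms dense]) (simp add: that)
    show "\<exists>E. vl_ideal E \<and> E \<subseteq> H \<and> order_dense_in E H \<and>
          (\<forall>G. G \<subseteq> positive_part E \<and> disjoint_elements G \<and> order_bounded_in G UNIV
             \<longrightarrow> order_bounded_in G H)" if "projection_band H"
      by (rule exI[of _ H]) (simp add: assms dense order_bounded_in_projection_band[OF that])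
    show "projection_band H"
      if "\<exists>E. vl_ideal E \<and> E \<subseteq> H \<and> order_dense_in E H \<and>
          (\<forall>G. G \<subseteq> positive_part E \<and> disjoint_elements G \<and> order_bounded_in G UNIV
             \<longrightarrow> order_bounded_in G H)"
      using that by (elim exE conjE) (rule bounded_imp, assumption, assumption, rule mp, erule spec, simp)
    show "projection_band H"
      if "\<exists>E. vl_ideal E \<and> countably_generated_ideal E \<and> E \<subseteq> H \<and> order_dense_in E H \<and>
        (\<forall>G. G \<subseteq> positive_part E \<and> countable G \<and> disjoint_elements G \<and> order_bounded_in G UNIV
           \<longrightarrow> order_bounded_in G H)"
      using that by (elim exE conjE) (rule countable_imp, assumption, assumption, assumption, rule mp, erule spec, simp)
  qed
qed

end
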